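(* Consider quadratic regression with a covariate uniformly distributed on $[-1,1]$, i.e. $f_X(x)=\frac12\mathbf{1}_{[-1,1]}(x)$. For $0<\alpha<1$ let $\xi^*_\alpha$ be the $D$-optimal subsampling design of mass $\alpha$, which has density $$f_{\xi^*_\alpha}(x)=\tfrac12\,\mathbf{1}_{[-1,-a]\cup[-b,b]\cup[a,1]}(x),$$ with $a=a(\alpha)$ and $b=b(\alpha)$ given by $$a(\alpha)=\tfrac12(1-\alpha)+\left(\frac{45-15\alpha+15\alpha^2-45\alpha^3+20\alpha^4-4\alpha\sqrt5\,\sqrt{45-90\alpha+90\alpha^2-75\alpha^3+57\alpha^4-27\alpha^5+5\alpha^6}}{180(1-\alpha)}\right)^{1/2}$$ and $$b(\alpha)=a(\alpha)-(1-\alpha).$$ Then $$\lim_{\alpha\to0}\frac{\xi^*_\alpha([-b(\alpha),b(\alpha)])}{\alpha}=\frac13 .$$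
   Context: Quadratic regression: $\mathbf{f}(x)=(1,x,x^2)^\top$. A (continuous) subsampling design $\xi$ of mass $\alpha$ is a measure on $\mathbb{R}$ with Lebesgue density $f_\xi$ satisfying $0\le f_\xi(x)\le f_X(x)$ for all $x$ and $\int f_\xi(x)\,dx=\alpha$ (densities are understood up to Lebesgue null sets). Its information matrix is $\mathbf{M}(\xi)=\int \mathbf{f}(x)\mathbf{f}(x)^\top f_\xi(x)\,dx$. The $D$-optimal subsampling design is the one maximizing $\log\det\mathbf{M}(\xi)$ among all subsampling designs $\xi$ of mass $\alpha$. $\mathbf{1}_A$ is the indicator function of $A$. *)

theory Defs
  imports "HOL-Analysis.Analysis"
begin

definition regression :: "real \<Rightarrow> real ^ 3"  where
  "regression x = vector [1, x, x\<^sup>2]"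

text \<open>
  A design is represented by the measure itself, so two Lebesgue densities that agree up to a
  null set give the same design.  Every measure on the Borel sets with a Lebesgue measurable
  density also has a Borel measurable one, so using \<^term>\<open>lborel\<close> loses nothing; likewise a
  density that satisfies the bounds almost everywhere can be changed on a null set so as to
  satisfy them everywhere.
\<close>
definition subsampling_design :: "(real \<Rightarrow> real) \<Rightarrow> real \<Rightarrow> real measure \<Rightarrow> bool" where
  "subsampling_design f\<^sub>X \<alpha> \<xi> \<longleftrightarrow>
     (\<exists>f. integrable lborel f \<and> (\<forall>x. 0 \<le> f x \<and> f x \<le> f\<^sub>X x) \<and>
          (\<integral>x. f x \<partial>lborel) = \<alpha> \<and> \<xi> = density lborel (\<lambda>x. ennreal (f x)))"

text \<open>
  The entrywise integral with respect to \<open>\<xi>\<close>; for a design with density \<open>f\<close> this is the Lebesgue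
  integral of the entry multiplied by \<open>f\<close>.  The integrals exist if \<open>\<xi>\<close> is finite with bounded support.
\<close>
definition information_matrix :: "real measure \<Rightarrow> real ^ 3 ^ 3" where
  "information_matrix \<xi> = (\<chi> i j. \<integral>x. regression x $ i * regression x $ j \<partial>\<xi>)"

text \<open>
  Extended-real valued because the library has \<open>ln 0 = 0\<close>, whereas a singular information matrix
  must be the worst possible one.
\<close>
definition log_det :: "real ^ 3 ^ 3 \<Rightarrow> ereal" where
  "log_det M = (if det M > 0 then ereal (ln (det M)) else -\<infinity>)"

definition is_D_optimal :: "(real \<Rightarrow> real) \<Rightarrow> real \<Rightarrow> real measure \<Rightarrow> bool" where
  "is_D_optimal f\<^sub>X \<alpha> \<xi> \<longleftrightarrow> subsampling_design f\<^sub>X \<alpha> \<xi> \<and>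
     (\<forall>\<eta>. subsampling_design f\<^sub>X \<alpha> \<eta> \<longrightarrow>
        log_det (information_matrix \<eta>) \<le> log_det (information_matrix \<xi>))"

definition D_optimal_design :: "(real \<Rightarrow> real) \<Rightarrow> real \<Rightarrow> real measure" where
  "D_optimal_design f\<^sub>X \<alpha> = (THE \<xi>. is_D_optimal f\<^sub>X \<alpha> \<xi>)"

definition uniform_density :: "real \<Rightarrow> real" where
  "uniform_density x = 1 / 2 * indicator {-1..1} x"

definition cut_a :: "real \<Rightarrow> real" where
  "cut_a \<alpha> = 1 / 2 * (1 - \<alpha>) +
     sqrt ((45 - 15 * \<alpha> + 15 * \<alpha>^2 - 45 * \<alpha>^3 + 20 * \<alpha>^4
            - 4 * \<alpha> * sqrt 5 *
              sqrt (45 - 90 * \<alpha> + 90 * \<alpha>^2 - 75 * \<alpha>^3 + 57 * \<alpha>^4 - 27 * \<alpha>^5 + 5 * \<alpha>^6))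
           / (180 * (1 - \<alpha>)))"

definition cut_b :: "real \<Rightarrow> real" where
  "cut_b \<alpha> = cut_a \<alpha> - (1 - \<alpha>)"

end

theory Submission
  imports Defs "HOL-Real_Asymp.Real_Asymp"
begin

text \<open>
  Write \<open>m\<^sub>k\<close> for the moments of a design. By a Schur complement the determinant of the information
  matrix is at most \<open>m\<^sub>2 (\<alpha> m\<^sub>4 - m\<^sub>2\<^sup>2)\<close>, with equality if the odd moments vanish, so symmetric
  designs suffice. For the candidate density, which is maximal exactly where the polynomial
  \<open>(x\<^sup>2 - a\<^sup>2) (x\<^sup>2 - b\<^sup>2)\<close> is nonnegative, the integral of this polynomial is maximal among all
  designs of mass \<open>\<alpha>\<close>. If \<open>a\<close> and \<open>b\<close> are balanced such that the polynomial is, up to scaling and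
  an additive constant, the gradient of \<open>log (m\<^sub>2 (\<alpha> m\<^sub>4 - m\<^sub>2\<^sup>2))\<close>, then concavity, here in the form of
  AM-GM, gives optimality; equality forces the two densities to agree almost everywhere.
\<close>

section \<open>Densities bounded by the uniform one, and their moments\<close>

definition admissible :: "real \<Rightarrow> (real \<Rightarrow> real) \<Rightarrow> bool" where
  "admissible \<alpha> f \<longleftrightarrow> integrable lborel f \<and> (\<forall>x. 0 \<le> f x \<and> f x \<le> uniform_density x) \<and>
     (\<integral>x. f x \<partial>lborel) = \<alpha>"

definition moment :: "(real \<Rightarrow> real) \<Rightarrow> nat \<Rightarrow> real" where
  "moment f k = (\<integral>x. x ^ k * f x \<partial>lborel)"

definition design_of :: "(real \<Rightarrow> real) \<Rightarrow> real measure" where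
  "design_of f = density lborel (\<lambda>x. ennreal (f x))"

lemma subsampling_design_iff:
  "subsampling_design uniform_density \<alpha> \<xi> \<longleftrightarrow> (\<exists>f. admissible \<alpha> f \<and> \<xi> = design_of f)"
  by (auto simp: subsampling_design_def admissible_def design_of_def)

lemma admissible_outside:
  assumes "admissible \<alpha> f" and "\<bar>x\<bar> > 1"
  shows "f x = 0"
proof -
  have "uniform_density x = 0"
    using assms(2) by (auto simp: uniform_density_def indicator_def)
  then show ?thesis
    using assms(1) unfolding admissible_def by (metis antisym)
qed

text \<open>The density vanishes off [-1,1], and on that interval \<bar>x\<bar>^k is at most 1, so
  \<open>f\<close> itself dominates the integrand.\<close>

lemma integrable_moment:
  assumes "admissible \<alpha> f"
  shows "integrable lborel (\<lambda>x. x ^ k * f x)"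
proof (rule Bochner_Integration.integrable_bound)
  show int: "integrable lborel f"
    using assms by (simp add: admissible_def)
  then show "(\<lambda>x. x ^ k * f x) \<in> borel_measurable lborel"
    by measurable
  show "AE x in lborel. norm (x ^ k * f x) \<le> norm (f x)"
  proof (rule AE_I2)
    fix x :: real
    show "norm (x ^ k * f x) \<le> norm (f x)"
    proof (cases "\<bar>x\<bar> > 1")
      case True
      then show ?thesis using admissible_outside[OF assms] by simp
    next
      case False
      then have "\<bar>x\<bar> ^ k \<le> 1" by (simp add: power_le_one)
      then show ?thesis by (simp add: abs_mult power_abs mult_left_le_one_le)
    qed
  qed
qed

lemma moment_0: "admissible \<alpha> f \<Longrightarrow> moment f 0 = \<alpha>"
  by (simp add: moment_def admissible_def)

text \<open>The squares used for the determinant and the level polynomial are all even quartics, so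
  their integrals depend only on the mass and on the second and fourth moments.\<close>

lemma integral_even_quartic:
  assumes "admissible \<alpha> f"
  shows "integrable lborel (\<lambda>x. (c + d * x\<^sup>2 + e * x ^ 4) * f x)"
    and "(\<integral>x. (c + d * x\<^sup>2 + e * x ^ 4) * f x \<partial>lborel) = c * \<alpha> + d * moment f 2 + e * moment f 4"
proof -
  note int = integrable_moment[OF assms]
  have eq: "(\<lambda>x. (c + d * x\<^sup>2 + e * x ^ 4) * f x) =
      (\<lambda>x. c * (x ^ 0 * f x) + d * (x ^ 2 * f x) + e * (x ^ 4 * f x))"
    by (simp add: algebra_simps)
  show "integrable lborel (\<lambda>x. (c + d * x\<^sup>2 + e * x ^ 4) * f x)"
    unfolding eq by (intro Bochner_Integration.integrable_add integrable_mult_right int)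
  show "(\<integral>x. (c + d * x\<^sup>2 + e * x ^ 4) * f x \<partial>lborel) = c * \<alpha> + d * moment f 2 + e * moment f 4"
    unfolding eq moment_0[OF assms, symmetric] moment_def
    using int by (simp only: Bochner_Integration.integral_add integral_mult_right_zero
        integrable_mult_right Bochner_Integration.integrable_add)
qed

section \<open>Determinant of the information matrix\<close>

text \<open>The matrix is the Hankel matrix of the moments 0 to 4. The subtracted bracket collects
  all terms that contain an odd moment.\<close>

lemma det_information_matrix:
  assumes "admissible \<alpha> f"
  shows "det (information_matrix (design_of f)) =
    moment f 2 * (\<alpha> * moment f 4 - (moment f 2)\<^sup>2) -
    (\<alpha> * (moment f 3)\<^sup>2 - 2 * moment f 1 * moment f 2 * moment f 3 + (moment f 1)\<^sup>2 * moment f 4)"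
proof -
  have meas: "f \<in> borel_measurable lborel"
    using assms by (auto simp: admissible_def)
  have moment_eq: "(\<integral>x. g x \<partial>design_of f) = moment f k"
    if "\<And>x. g x = x ^ k" for g k
  proof -
    have "g = (\<lambda>x. x ^ k)" using that by (rule ext)
    then show ?thesis
      unfolding design_of_def moment_def using meas assms
      by (subst integral_density) (auto simp: admissible_def mult.commute)
  qed
  have entries: "information_matrix (design_of f) $ 1 $ 1 = moment f 0"
    "information_matrix (design_of f) $ 1 $ 2 = moment f 1"
    "information_matrix (design_of f) $ 1 $ 3 = moment f 2"
    "information_matrix (design_of f) $ 2 $ 1 = moment f 1"
    "information_matrix (design_of f) $ 2 $ 2 = moment f 2"
    "information_matrix (design_of f) $ 2 $ 3 = moment f 3"
    "information_matrix (design_of f) $ 3 $ 1 = moment f 2"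
    "information_matrix (design_of f) $ 3 $ 2 = moment f 3"
    "information_matrix (design_of f) $ 3 $ 3 = moment f 4"
    by (simp_all add: information_matrix_def regression_def power2_eq_square power3_eq_cube
        power4_eq_xxxx mult.assoc moment_eq del: lebesgue_integral_const)
  show ?thesis
    unfolding det_3 entries moment_0[OF assms] by (simp add: algebra_simps power2_eq_square)
qed

text \<open>The bracket with the odd moments is the integral of
  \<open>(m 3 - m 1 * x\<^sup>2)\<^sup>2\<close> against \<open>f\<close>, hence
  nonnegative.\<close>

lemma det_information_matrix_le:
  assumes "admissible \<alpha> f"
  shows "det (information_matrix (design_of f)) \<le> moment f 2 * (\<alpha> * moment f 4 - (moment f 2)\<^sup>2)"
proof -
  define m where "m = moment f"
  have "0 \<le> (\<integral>x. (m 3 - m 1 * x\<^sup>2)\<^sup>2 * f x \<partial>lborel)"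
    using assms by (intro integral_nonneg_AE) (auto simp: admissible_def)
  also have "\<dots> = (\<integral>x. ((m 3)\<^sup>2 + (- 2 * m 1 * m 3) * x\<^sup>2 + (m 1)\<^sup>2 * x ^ 4) * f x \<partial>lborel)"
    by (rule Bochner_Integration.integral_cong) (auto simp: algebra_simps power2_eq_square power4_eq_xxxx)
  also have "\<dots> = (m 3)\<^sup>2 * \<alpha> + (- 2 * m 1 * m 3) * m 2 + (m 1)\<^sup>2 * m 4"
    unfolding m_def by (rule integral_even_quartic[OF assms])
  finally show ?thesis
    unfolding det_information_matrix[OF assms] m_def by (simp add: algebra_simps)
qed

text \<open>If the integral were zero, the integrand would vanish almost everywhere. As
  \<open>h\<close> has only finitely many zeros, \<open>f\<close> would then vanish almost
  everywhere, contradicting its positive mass.\<close>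

lemma integral_mult_pos:
  assumes f: "admissible \<alpha> f" and "\<alpha> > 0"
    and int: "integrable lborel (\<lambda>x. h x * f x)"
    and nonneg: "\<And>x. 0 \<le> h x" and fin: "finite {x. h x = 0}"
  shows "0 < (\<integral>x. h x * f x \<partial>lborel)"
proof -
  have nn: "AE x in lborel. 0 \<le> h x * f x"
    using f nonneg by (auto simp: admissible_def)
  have "(\<integral>x. h x * f x \<partial>lborel) \<noteq> 0"
  proof
    assume "(\<integral>x. h x * f x \<partial>lborel) = 0"
    then have "AE x in lborel. h x * f x = 0"
      using integral_nonneg_eq_0_iff_AE[OF int nn] by simp
    moreover have "AE x in lborel. x \<notin> {x. h x = 0}"
      by (rule AE_not_in) (simp add: fin finite_imp_null_set_lborel)
    ultimately have "AE x in lborel. f x = 0"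
      by eventually_elim auto
    then have "(\<integral>x. f x \<partial>lborel) = 0"
      by (rule integral_eq_zero_AE)
    with f \<open>\<alpha> > 0\<close> show False by (simp add: admissible_def)
  qed
  with integral_nonneg_AE[OF nn] show ?thesis by simp
qed

lemma moment_2_pos:
  assumes f: "admissible \<alpha> f" and "\<alpha> > 0"
  shows "moment f 2 > 0"
  unfolding moment_def
  by (rule integral_mult_pos[OF assms integrable_moment[OF f]]) auto

text \<open>This is the strict Cauchy-Schwarz inequality for 1 and x^2: \<alpha> times the gap is
  the integral of \<open>(\<alpha> * x\<^sup>2 - m)\<^sup>2\<close> against \<open>f\<close>, and
  this square has at most two zeros.\<close>

lemma moment_gap_pos:
  assumes f: "admissible \<alpha> f" and "\<alpha> > 0"
  shows "\<alpha> * moment f 4 - (moment f 2)\<^sup>2 > 0"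
proof -
  define m where "m = moment f 2"
  have eq: "(\<alpha> * x\<^sup>2 - m)\<^sup>2 = m\<^sup>2 + (- 2 * \<alpha> * m) * x\<^sup>2 + \<alpha>\<^sup>2 * x ^ 4" for x
    by (simp add: algebra_simps power2_eq_square power4_eq_xxxx)
  have "{x. (\<alpha> * x\<^sup>2 - m)\<^sup>2 = 0} \<subseteq> {sqrt (m / \<alpha>), - sqrt (m / \<alpha>)}"
  proof
    fix x assume "x \<in> {x. (\<alpha> * x\<^sup>2 - m)\<^sup>2 = 0}"
    then have "x\<^sup>2 = m / \<alpha>" using \<open>\<alpha> > 0\<close> by (auto simp: field_simps)
    then have "\<bar>x\<bar> = sqrt (m / \<alpha>)" by (metis real_sqrt_abs)
    then show "x \<in> {sqrt (m / \<alpha>), - sqrt (m / \<alpha>)}" by (auto simp: abs_if split: if_splits)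
  qed
  then have "finite {x. (\<alpha> * x\<^sup>2 - m)\<^sup>2 = 0}"
    by (rule finite_subset) simp
  then have "0 < (\<integral>x. (\<alpha> * x\<^sup>2 - m)\<^sup>2 * f x \<partial>lborel)"
    by (intro integral_mult_pos[OF assms] zero_le_power2) (simp only: eq integral_even_quartic(1)[OF f])
  also have "\<dots> = m\<^sup>2 * \<alpha> + (- 2 * \<alpha> * m) * moment f 2 + \<alpha>\<^sup>2 * moment f 4"
    unfolding eq by (rule integral_even_quartic[OF f])
  also have "\<dots> = \<alpha> * (\<alpha> * moment f 4 - (moment f 2)\<^sup>2)"
    by (simp add: m_def algebra_simps power2_eq_square)
  finally show ?thesis using \<open>\<alpha> > 0\<close> by (simp add: zero_less_mult_iff)
qed

section \<open>AM-GM argument for the product of two factors\<close>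

text \<open>Here \<open>p\<close>, \<open>D\<close> stand for the two factors of a competitor's
  determinant bound and \<open>P\<close>, \<open>E\<close> for those of the candidate. AM-GM bounds
  \<open>P * D + E * p\<close> below by \<open>2 * P * E\<close>, so \<open>tangent\<close> leaves
  no room for the term \<open>P * (p - P)\<^sup>2\<close>.\<close>

lemma product_ge_imp_eq:
  fixes p D P E :: real
  assumes pos: "p > 0" "D > 0" "P > 0" "E > 0"
    and ge: "P * E \<le> p * D"
    and tangent: "P * D + E * p + P * (p - P)\<^sup>2 \<le> 2 * P * E"
  shows "p = P" and "D = E"
proof -
  have "(2 * (P * E))\<^sup>2 = 4 * ((P * E) * (P * E))"
    by (simp add: power2_eq_square)
  \<comment> \<open>Regrouped, the product is \<open>(P * D) * (E * p)\<close>, to which 4xy \<le>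
    (x + y)^2 applies.\<close>
  also have "\<dots> \<le> 4 * ((P * E) * (p * D))"
    using ge pos by simp
  also have "\<dots> \<le> (P * D + E * p)\<^sup>2"
    using zero_le_power2[of "P * D - E * p"] by (simp add: power2_eq_square algebra_simps)
  finally have amgm: "2 * (P * E) \<le> P * D + E * p"
    using pos by (meson add_nonneg_nonneg less_imp_le mult_nonneg_nonneg power2_le_imp_le)
  then have "P * (p - P)\<^sup>2 \<le> 0"
    using tangent by (simp add: algebra_simps)
  then show "p = P"
    using pos by (simp add: mult_le_0_iff)
  with tangent ge pos show "D = E"
    by (simp add: algebra_simps)
qed

section \<open>The candidate density and its moments\<close>

definition cut_density :: "real \<Rightarrow> real \<Rightarrow> real \<Rightarrow> real" where
  "cut_density a b x = 1 / 2 * indicator ({-1..-a} \<union> {-b..b} \<union> {a..1}) x"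

lemma moment_cut_density_power:
  assumes "0 \<le> b" "b < a" "a \<le> 1"
  shows "integrable lborel (\<lambda>x. x ^ k * cut_density a b x)"
    and "moment (cut_density a b) k =
      ((- a) ^ Suc k - (- 1) ^ Suc k + (b ^ Suc k - (- b) ^ Suc k) + (1 - a ^ Suc k)) / (2 * Suc k)"
proof -
  \<comment> \<open>The three intervals are pairwise disjoint, so the indicator of their union is
    the sum of their indicators.\<close>
  have eq: "(\<lambda>x. x ^ k * cut_density a b x) = (\<lambda>x. 1 / 2 * (x ^ k * indicator {-1..-a} x) +
      1 / 2 * (x ^ k * indicator {-b..b} x) + 1 / 2 * (x ^ k * indicator {a..1} x))"
    using assms by (auto simp: cut_density_def indicator_def fun_eq_iff)
  have int: "integrable lborel (\<lambda>x. x ^ k * indicator {c..d} x)" for c d :: real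
    using borel_integrable_atLeastAtMost[of c d "\<lambda>x. x ^ k"]
    by (simp add: indicator_def if_distrib cong: if_cong)
  show "integrable lborel (\<lambda>x. x ^ k * cut_density a b x)"
    unfolding eq by (intro Bochner_Integration.integrable_add integrable_mult_right int)
  have "moment (cut_density a b) k =
      1 / 2 * (((- a) ^ Suc k - (- 1) ^ Suc k) / Suc k) + 1 / 2 * ((b ^ Suc k - (- b) ^ Suc k) / Suc k)
      + 1 / 2 * ((1 ^ Suc k - a ^ Suc k) / Suc k)"
    unfolding moment_def eq using int assms
    by (simp only: Bochner_Integration.integral_add integral_mult_right_zero
        integrable_mult_right Bochner_Integration.integrable_add integral_power)
  moreover have "1 / 2 * (p / n) + 1 / 2 * (q / n) + 1 / 2 * (r / n) = (p + q + r) / (2 * n)"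
    for p q r n :: real
    by (simp add: add_divide_distrib)
  ultimately show "moment (cut_density a b) k =
      ((- a) ^ Suc k - (- 1) ^ Suc k + (b ^ Suc k - (- b) ^ Suc k) + (1 - a ^ Suc k)) / (2 * Suc k)"
    by (simp only: power_one of_nat_mult of_nat_numeral)
qed

lemma moments_cut_density:
  assumes "0 \<le> b" "b < a" "a \<le> 1"
  shows "moment (cut_density a b) 0 = 1 - a + b"
    "moment (cut_density a b) 1 = 0"
    "moment (cut_density a b) 2 = (1 - a ^ 3 + b ^ 3) / 3"
    "moment (cut_density a b) 3 = 0"
    "moment (cut_density a b) 4 = (1 - a ^ 5 + b ^ 5) / 5"
  unfolding moment_cut_density_power(2)[OF assms] by (simp_all add: field_simps)

lemma admissible_cut_density:
  assumes "0 \<le> b" "b < a" "a \<le> 1"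
  shows "admissible (1 - a + b) (cut_density a b)"
  unfolding admissible_def
proof (intro conjI allI)
  show "integrable lborel (cut_density a b)"
    using moment_cut_density_power(1)[OF assms, of 0] by simp
  show "(\<integral>x. cut_density a b x \<partial>lborel) = 1 - a + b"
    using moments_cut_density(1)[OF assms] by (simp add: moment_def)
  fix x
  show "0 \<le> cut_density a b x" "cut_density a b x \<le> uniform_density x"
    using assms by (auto simp: cut_density_def uniform_density_def indicator_def)
qed

section \<open>The level polynomial and its maximal integral\<close>

text \<open>Bathtub principle, pointwise: on [-1,1] the candidate sits at the upper bound 1/2 where
  the polynomial is nonnegative and at the lower bound 0 where it is negative, so both factors have
  compatible signs.\<close>

lemma level_polynomial_nonneg:
  assumes ab: "0 \<le> b" "b < a" "a \<le> 1" and g: "admissible \<alpha> g"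
  shows "0 \<le> (x\<^sup>2 - a\<^sup>2) * (x\<^sup>2 - b\<^sup>2) * (cut_density a b x - g x)"
proof (cases "\<bar>x\<bar> > 1")
  case True
  with ab have "cut_density a b x = 0"
    by (auto simp: cut_density_def indicator_def)
  with admissible_outside[OF g True] show ?thesis by simp
next
  case False
  then have "uniform_density x = 1 / 2"
    by (auto simp: uniform_density_def indicator_def abs_if split: if_splits)
  then have g_le: "0 \<le> g x" "g x \<le> 1 / 2"
    using g unfolding admissible_def by metis+
  have a2: "a\<^sup>2 \<le> x\<^sup>2" if "a \<le> \<bar>x\<bar>"
    using that ab by (metis abs_of_nonneg abs_le_square_iff dual_order.trans less_imp_le)
  have a2': "x\<^sup>2 \<le> a\<^sup>2" if "\<bar>x\<bar> \<le> a"
    using that by (metis abs_ge_zero power2_abs power_mono)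
  have b2: "b\<^sup>2 \<le> x\<^sup>2" if "b \<le> \<bar>x\<bar>"
    using that ab by (metis power2_abs power_mono)
  have b2': "x\<^sup>2 \<le> b\<^sup>2" if "\<bar>x\<bar> \<le> b"
    using that by (metis abs_ge_zero power2_abs power_mono)
  consider "\<bar>x\<bar> \<le> b" | "b < \<bar>x\<bar>" "\<bar>x\<bar> < a" | "a \<le> \<bar>x\<bar>" by linarith
  then show ?thesis
  proof cases
    case 1
    then have "cut_density a b x = 1 / 2" by (auto simp: cut_density_def indicator_def)
    with 1 g_le a2' b2' ab show ?thesis
      by (intro mult_nonneg_nonneg mult_nonpos_nonpos) auto
  next
    case 2
    then have "cut_density a b x = 0" by (auto simp: cut_density_def indicator_def)
    with 2 g_le a2' b2 ab show ?thesis
      by (intro mult_nonpos_nonpos mult_nonpos_nonneg) auto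
  next
    case 3
    with False have "cut_density a b x = 1 / 2"
      by (auto simp: cut_density_def indicator_def abs_if split: if_splits)
    with 3 g_le a2 b2 ab show ?thesis
      by (intro mult_nonneg_nonneg) auto
  qed
qed

text \<open>The pointwise inequality is integrated; the constant term
  \<open>a\<^sup>2 * b\<^sup>2\<close> cancels because both densities have the same mass. In case of
  equality the integrand vanishes almost everywhere, so the densities agree off the roots of the
  polynomial, a null set.\<close>

lemma level_polynomial_moments:
  assumes ab: "0 \<le> b" "b < a" "a \<le> 1" and g: "admissible (1 - a + b) g"
  defines "F \<equiv> cut_density a b"
  shows "moment g 4 - (a\<^sup>2 + b\<^sup>2) * moment g 2 \<le> moment F 4 - (a\<^sup>2 + b\<^sup>2) * moment F 2"
    and "moment g 4 - (a\<^sup>2 + b\<^sup>2) * moment g 2 = moment F 4 - (a\<^sup>2 + b\<^sup>2) * moment F 2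
      \<Longrightarrow> design_of g = design_of F"
proof -
  define h where "h x = (x\<^sup>2 - a\<^sup>2) * (x\<^sup>2 - b\<^sup>2)" for x :: real
  have h_eq: "h x = a\<^sup>2 * b\<^sup>2 + (- (a\<^sup>2 + b\<^sup>2)) * x\<^sup>2 + 1 * x ^ 4" for x
    by (simp add: h_def algebra_simps power2_eq_square power4_eq_xxxx)
  have F: "admissible (1 - a + b) F"
    unfolding F_def by (rule admissible_cut_density[OF ab])
  have eq: "(\<lambda>x. h x * (F x - g x)) = (\<lambda>x. h x * F x - h x * g x)"
    by (simp add: right_diff_distrib)
  have ints: "integrable lborel (\<lambda>x. h x * F x)" "integrable lborel (\<lambda>x. h x * g x)"
    unfolding h_eq by (rule integral_even_quartic[OF F] integral_even_quartic[OF g])+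
  have int: "integrable lborel (\<lambda>x. h x * (F x - g x))"
    unfolding eq using ints by simp
  have nn: "AE x in lborel. 0 \<le> h x * (F x - g x)"
    using level_polynomial_nonneg[OF ab g] by (simp add: h_def F_def)
  have val: "(\<integral>x. h x * (F x - g x) \<partial>lborel) =
      (moment F 4 - (a\<^sup>2 + b\<^sup>2) * moment F 2) - (moment g 4 - (a\<^sup>2 + b\<^sup>2) * moment g 2)"
    unfolding eq Bochner_Integration.integral_diff[OF ints]
    unfolding h_eq integral_even_quartic(2)[OF F] integral_even_quartic(2)[OF g]
    by (simp add: algebra_simps)
  show "moment g 4 - (a\<^sup>2 + b\<^sup>2) * moment g 2 \<le> moment F 4 - (a\<^sup>2 + b\<^sup>2) * moment F 2"
    using integral_nonneg_AE[OF nn] val by simp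
  assume "moment g 4 - (a\<^sup>2 + b\<^sup>2) * moment g 2 = moment F 4 - (a\<^sup>2 + b\<^sup>2) * moment F 2"
  then have "AE x in lborel. h x * (F x - g x) = 0"
    using integral_nonneg_eq_0_iff_AE[OF int nn] val by simp
  moreover have "AE x in lborel. x \<notin> {a, -a, b, -b}"
    by (rule AE_not_in) (simp add: finite_imp_null_set_lborel)
  ultimately have "AE x in lborel. ennreal (g x) = ennreal (F x)"
    by eventually_elim (auto simp: h_def power2_eq_iff)
  then show "design_of g = design_of F"
    unfolding design_of_def using F g by (intro density_cong) (auto simp: admissible_def)
qed

section \<open>Optimality and uniqueness for balanced cut points\<close>

text \<open>The derivatives of log (m2 (\<alpha> m4 - m2^2)) with respect to m2 and m4 are 1/P -
  2P/E and \<alpha>/E at the candidate. The assumption \<open>balance\<close> says that their ratio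
  is -(a^2 + b^2), the ratio of the x^2 and x^4 coefficients of the level polynomial.\<close>

theorem cut_density_D_optimal:
  fixes a b :: real
  defines "\<alpha> \<equiv> 1 - a + b" and "F \<equiv> cut_density a b"
  assumes ab: "0 \<le> b" "b < a" "a \<le> 1" and pos: "\<alpha> > 0"
    and balance: "\<alpha> * moment F 2 * (a\<^sup>2 + b\<^sup>2) = 3 * (moment F 2)\<^sup>2 - \<alpha> * moment F 4"
  shows "is_D_optimal uniform_density \<alpha> (design_of F)"
    and "is_D_optimal uniform_density \<alpha> \<xi> \<Longrightarrow> \<xi> = design_of F"
proof -
  define P where "P = moment F 2"
  define E where "E = \<alpha> * moment F 4 - P\<^sup>2"
  have F: "admissible \<alpha> F"
    unfolding F_def \<alpha>_def by (rule admissible_cut_density[OF ab])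
  have P: "P > 0" and E: "E > 0"
    unfolding P_def E_def using moment_2_pos[OF F pos] moment_gap_pos[OF F pos] by auto
  have det_F: "det (information_matrix (design_of F)) = P * E"
    unfolding det_information_matrix[OF F] E_def P_def
    by (simp add: F_def moments_cut_density(2,4)[OF ab] del: One_nat_def)
  \<comment> \<open>This one fact serves both claims: a competitor that is at least as good is the
    candidate itself.\<close>
  have key: "design_of g = design_of F"
    if g: "admissible \<alpha> g" and ge: "P * E \<le> det (information_matrix (design_of g))" for g
  proof -
    define p where "p = moment g 2"
    define D where "D = \<alpha> * moment g 4 - p\<^sup>2"
    have g': "admissible (1 - a + b) g" using g by (simp add: \<alpha>_def)
    have p: "p > 0" and D: "D > 0"
      unfolding p_def D_def using moment_2_pos[OF g pos] moment_gap_pos[OF g pos] by auto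
    have ge': "P * E \<le> p * D"
      using ge det_information_matrix_le[OF g] by (simp add: p_def D_def)
    have bal: "P * (\<alpha> * (a\<^sup>2 + b\<^sup>2)) = 2 * P\<^sup>2 - E"
      using balance by (simp add: E_def P_def algebra_simps)
    have "\<alpha> * moment g 4 - \<alpha> * (a\<^sup>2 + b\<^sup>2) * p \<le> \<alpha> * moment F 4 - \<alpha> * (a\<^sup>2 + b\<^sup>2) * P"
      using mult_left_mono[OF level_polynomial_moments(1)[OF ab g'] less_imp_le[OF pos]]
      by (simp add: p_def P_def F_def algebra_simps)
    \<comment> \<open>The fourth moments are eliminated through \<alpha> m4 = D + p^2 and \<alpha>
      m4 = E + P^2; the factor \<open>P\<close> prepares the use of \<open>bal\<close>.\<close>
    then have "P * (D + p\<^sup>2 - E - P\<^sup>2) \<le> P * (\<alpha> * (a\<^sup>2 + b\<^sup>2) * (p - P))"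
      using P by (intro mult_left_mono) (auto simp: D_def E_def algebra_simps)
    also have "\<dots> = (2 * P\<^sup>2 - E) * (p - P)"
      using bal by (simp add: mult.assoc[symmetric])
    finally have "P * D + E * p + P * (p - P)\<^sup>2 \<le> 2 * P * E"
      by (simp add: algebra_simps power2_eq_square)
    then have "p = P" "D = E"
      using product_ge_imp_eq[OF p D P E ge'] by auto
    then have "moment g 4 = moment F 4" "moment g 2 = moment F 2"
      using pos by (simp_all add: p_def P_def D_def E_def)
    then show ?thesis
      using level_polynomial_moments(2)[OF ab g'] by (simp add: F_def)
  qed
  have log_det_F: "log_det (information_matrix (design_of F)) = ereal (ln (P * E))"
    using P E by (simp add: log_det_def det_F)
  show opt: "is_D_optimal uniform_density \<alpha> (design_of F)"
    unfolding is_D_optimal_def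
  proof (intro conjI allI impI)
    show "subsampling_design uniform_density \<alpha> (design_of F)"
      using F by (auto simp: subsampling_design_iff)
    fix \<eta> assume "subsampling_design uniform_density \<alpha> \<eta>"
    then obtain g where g: "admissible \<alpha> g" "\<eta> = design_of g"
      by (auto simp: subsampling_design_iff)
    show "log_det (information_matrix \<eta>) \<le> log_det (information_matrix (design_of F))"
    proof (cases "P * E \<le> det (information_matrix \<eta>)")
      case True
      with key g show ?thesis by simp
    next
      case False
      then show ?thesis unfolding log_det_F using P E by (auto simp: log_det_def)
    qed
  qed
  assume opt_\<xi>: "is_D_optimal uniform_density \<alpha> \<xi>"
  then obtain g where g: "admissible \<alpha> g" "\<xi> = design_of g"
    by (auto simp: is_D_optimal_def subsampling_design_iff)
  \<comment> \<open>The left side is finite, which excludes the value -\<infinity> on the right;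
    hence the determinant is positive and \<open>ln\<close> can be removed.\<close>
  have "ereal (ln (P * E)) \<le> log_det (information_matrix \<xi>)"
    using opt opt_\<xi> by (auto simp: is_D_optimal_def log_det_F[symmetric])
  then have "P * E \<le> det (information_matrix \<xi>)"
    using P E by (auto simp: log_det_def split: if_splits)
  with key g show "\<xi> = design_of F" by simp
qed

section \<open>The quadratic equation for the cut points\<close>

text \<open>By the sign at \<open>v\<close>, this point lies strictly between the two roots. By the
  sign at \<open>u\<close>, that point lies outside them, and being left of \<open>v\<close> it is
  left of the smaller root.\<close>

lemma smaller_root_between:
  fixes A B C u v :: real
  assumes A: "A > 0" and u: "A * u\<^sup>2 + B * u + C > 0" and v: "A * v\<^sup>2 + B * v + C < 0" and "u < v"
  defines "r \<equiv> (- B - sqrt (B\<^sup>2 - 4 * A * C)) / (2 * A)"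
  shows "A * r\<^sup>2 + B * r + C = 0" and "u < r" and "r < v"
proof -
  define s where "s = sqrt (B\<^sup>2 - 4 * A * C)"
  have complete: "4 * A * (A * x\<^sup>2 + B * x + C) = (2 * A * x + B)\<^sup>2 - (B\<^sup>2 - 4 * A * C)" for x
    by (simp add: algebra_simps power2_eq_square)
  have vs: "(2 * A * v + B)\<^sup>2 < B\<^sup>2 - 4 * A * C"
    using v A complete[of v] by (smt (verit) mult_pos_neg)
  then have disc: "0 \<le> B\<^sup>2 - 4 * A * C" by (smt (verit) zero_le_power2)
  then have s2: "s\<^sup>2 = B\<^sup>2 - 4 * A * C" and s: "s \<ge> 0" by (simp_all add: s_def)
  have r: "2 * A * r = - B - s" using A by (simp add: r_def s_def)
  have "4 * A * (A * r\<^sup>2 + B * r + C) = 0"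
    unfolding complete r s2[symmetric] by (simp add: power2_eq_square)
  then show "A * r\<^sup>2 + B * r + C = 0" using A by simp
  have v_abs: "\<bar>2 * A * v + B\<bar> < s"
    using vs s2 s by (metis abs_of_nonneg power2_less_imp_less power2_abs)
  then have "2 * A * r < 2 * A * v" using r by linarith
  then show "r < v" using A by simp
  have "0 < 4 * A * (A * u\<^sup>2 + B * u + C)" using u A by simp
  then have "s\<^sup>2 < (2 * A * u + B)\<^sup>2" unfolding complete s2 by simp
  then have u_abs: "s < \<bar>2 * A * u + B\<bar>" using s by (metis abs_ge_zero power2_abs power2_less_imp_less)
  \<comment> \<open>Since \<bar>2Av + B\<bar> < s < \<bar>2Au + B\<bar>, this ordering excludes 2Au
    + B > s and leaves 2Au + B < -s.\<close>
  have "2 * A * u < 2 * A * v" using A \<open>u < v\<close> by simp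
  with u_abs v_abs have "2 * A * u < 2 * A * r" unfolding r by linarith
  then show "u < r" using A by simp
qed

text \<open>
  Substituting \<open>a = t + (1 - \<alpha>) / 2\<close> and \<open>b = t - (1 - \<alpha>) / 2\<close> turns the balance condition of
  \<open>cut_density_D_optimal\<close> into a quadratic equation for \<open>t\<^sup>2\<close>. The quadratic polynomial is positive
  at \<open>b = 0\<close> and negative at \<open>a = 1\<close>, so its smaller root is the admissible one.
\<close>
lemma cut_a_b_properties:
  assumes \<alpha>: "0 < \<alpha>" "\<alpha> < 1"
  defines "a \<equiv> cut_a \<alpha>" and "b \<equiv> cut_b \<alpha>"
  shows "0 < b" and "b < a" and "a < 1"
    and "\<alpha> * ((1 - a ^ 3 + b ^ 3) / 3) * (a\<^sup>2 + b\<^sup>2) =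
      3 * ((1 - a ^ 3 + b ^ 3) / 3)\<^sup>2 - \<alpha> * ((1 - a ^ 5 + b ^ 5) / 5)"
proof -
  define d where "d = 1 - \<alpha>"
  \<comment> \<open>\<open>A\<close>, \<open>B\<close>, \<open>C\<close> are the coefficients, as a
    polynomial in t^2, of the right side minus the left side of the balance condition;
    \<open>d\<close> is the gap a - b.\<close>
  define A where "A = 3 * d"
  define B where "B = - 2 * d + d ^ 4 / 2 + \<alpha> * d ^ 3 / 2 - 2 / 3 * \<alpha> * (1 - d ^ 3)"
  define C where "C = (1 - d ^ 3 / 4)\<^sup>2 / 3 - \<alpha> * (1 - d ^ 5 / 16) / 5 - \<alpha> * (1 - d ^ 3 / 4) * d\<^sup>2 / 6"
  have d: "0 < d" "d < 1" and \<alpha>_eq: "\<alpha> = 1 - d" using \<alpha> by (auto simp: d_def)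
  have balance: "3 * ((1 - (t + d / 2) ^ 3 + (t - d / 2) ^ 3) / 3)\<^sup>2
      - \<alpha> * ((1 - (t + d / 2) ^ 5 + (t - d / 2) ^ 5) / 5)
      - \<alpha> * ((1 - (t + d / 2) ^ 3 + (t - d / 2) ^ 3) / 3) * ((t + d / 2)\<^sup>2 + (t - d / 2)\<^sup>2)
      = A * (t\<^sup>2)\<^sup>2 + B * t\<^sup>2 + C" for t
  proof -
    have pow3: "1 - (t + d / 2) ^ 3 + (t - d / 2) ^ 3 = 1 - d * (3 * t\<^sup>2 + d\<^sup>2 / 4)"
      and pow5: "1 - (t + d / 2) ^ 5 + (t - d / 2) ^ 5 =
        1 - d * (5 * (t\<^sup>2)\<^sup>2 + 5 / 2 * t\<^sup>2 * d\<^sup>2 + d ^ 4 / 16)"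
      and pow2: "(t + d / 2)\<^sup>2 + (t - d / 2)\<^sup>2 = 2 * t\<^sup>2 + d\<^sup>2 / 2"
      by (simp_all add: field_simps eval_nat_numeral)
    have "3 * ((1 - d * (3 * u + d\<^sup>2 / 4)) / 3)\<^sup>2
        - \<alpha> * ((1 - d * (5 * u\<^sup>2 + 5 / 2 * u * d\<^sup>2 + d ^ 4 / 16)) / 5)
        - \<alpha> * ((1 - d * (3 * u + d\<^sup>2 / 4)) / 3) * (2 * u + d\<^sup>2 / 2) = A * u\<^sup>2 + B * u + C" for u
      unfolding A_def B_def C_def \<alpha>_eq by (simp add: field_simps eval_nat_numeral)
    then show ?thesis
      unfolding pow2 pow3 pow5 .
  qed
  define T where "T = (- B - sqrt (B\<^sup>2 - 4 * A * C)) / (2 * A)"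
  have at_u: "A * ((d / 2)\<^sup>2)\<^sup>2 + B * (d / 2)\<^sup>2 + C > 0"
  proof -
    have "A * ((d / 2)\<^sup>2)\<^sup>2 + B * (d / 2)\<^sup>2 + C =
        (1 - d)\<^sup>2 * (2 + 7 * d + 7 * d\<^sup>2 + 2 * d ^ 3 - 3 * d ^ 4) / 15"
      unfolding balance[symmetric] by (simp add: \<alpha>_eq field_simps eval_nat_numeral)
    \<comment> \<open>The only negative term, -3 d^4, is absorbed by 7 d.\<close>
    moreover have "d ^ 4 \<le> d" using d power_decreasing[of 1 4 d] by simp
    then have "0 < 2 + 7 * d + 7 * d\<^sup>2 + 2 * d ^ 3 - 3 * d ^ 4"
      using d by (smt (verit) zero_less_power)
    then have "0 < (1 - d)\<^sup>2 * (2 + 7 * d + 7 * d\<^sup>2 + 2 * d ^ 3 - 3 * d ^ 4) / 15"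
      using d by simp
    ultimately show ?thesis by (simp only:)
  qed
  have at_v: "A * ((1 - d / 2)\<^sup>2)\<^sup>2 + B * (1 - d / 2)\<^sup>2 + C < 0"
  proof -
    have "A * ((1 - d / 2)\<^sup>2)\<^sup>2 + B * (1 - d / 2)\<^sup>2 + C = - (\<alpha> ^ 6 / 5 + \<alpha> ^ 4 / 3)"
    proof -
      \<comment> \<open>At t = 1 - d/2 the cut points are a = 1 and b = \<alpha>, so the moment
        expressions reduce to powers of \<alpha>.\<close>
      have "1 - d / 2 + d / 2 = 1" "1 - d / 2 - d / 2 = \<alpha>" by (simp_all add: \<alpha>_eq)
      then show ?thesis
        using balance[of "1 - d / 2"] by (simp only:) (simp add: field_simps eval_nat_numeral)
    qed
    moreover have "0 < \<alpha> ^ 6 / 5 + \<alpha> ^ 4 / 3"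
      using \<alpha> by (intro add_pos_pos divide_pos_pos zero_less_power) auto
    ultimately show ?thesis by linarith
  qed
  have uv: "(d / 2)\<^sup>2 < (1 - d / 2)\<^sup>2"
    using d by (intro power_strict_mono) auto
  note T = smaller_root_between[OF _ at_u at_v uv, folded T_def]
  have A: "A > 0" using d by (simp add: A_def)
  have T_eq: "(45 - 15 * \<alpha> + 15 * \<alpha>^2 - 45 * \<alpha>^3 + 20 * \<alpha>^4 - 4 * \<alpha> * sqrt 5 *
      sqrt (45 - 90 * \<alpha> + 90 * \<alpha>^2 - 75 * \<alpha>^3 + 57 * \<alpha>^4 - 27 * \<alpha>^5 + 5 * \<alpha>^6)) / (180 * (1 - \<alpha>)) = T"
  proof -
    define Q where "Q = 45 - 90 * \<alpha> + 90 * \<alpha>^2 - 75 * \<alpha>^3 + 57 * \<alpha>^4 - 27 * \<alpha>^5 + 5 * \<alpha>^6"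
    \<comment> \<open>The discriminant has the square factor (2\<alpha>/15)^2; pulling it out of the
      root produces the nested radical of \<open>cut_a\<close>.\<close>
    have "B\<^sup>2 - 4 * A * C = (2 * \<alpha> / 15)\<^sup>2 * (5 * Q)"
      unfolding A_def B_def C_def Q_def d_def by (simp add: field_simps eval_nat_numeral)
    then have disc: "sqrt (B\<^sup>2 - 4 * A * C) = 2 * \<alpha> / 15 * (sqrt 5 * sqrt Q)"
      using \<alpha> by (simp only: real_sqrt_mult real_sqrt_abs abs_of_pos)
    have mB: "- B = (45 - 15 * \<alpha> + 15 * \<alpha>^2 - 45 * \<alpha>^3 + 20 * \<alpha>^4) / 30"
      unfolding B_def d_def by (simp add: field_simps eval_nat_numeral)
    show ?thesis
      unfolding T_def disc mB unfolding A_def Q_def[symmetric] using d by (simp add: d_def field_simps)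
  qed
  define t where "t = sqrt T"
  have a_eq: "a = t + d / 2" and b_eq: "b = t - d / 2"
    unfolding a_def b_def cut_b_def cut_a_def T_eq t_def d_def by (simp_all add: field_simps)
  have "T > 0" using T(2)[OF A] by (smt (verit) zero_le_power2)
  then have t2: "t\<^sup>2 = T" and t0: "t > 0" by (simp_all add: t_def)
  have "d / 2 < t" using T(2)[OF A] unfolding t2[symmetric]
    by (rule power2_less_imp_less) (use t0 in simp)
  then show "0 < b" by (simp add: b_eq)
  show "b < a" using d by (simp add: a_eq b_eq)
  have "t < 1 - d / 2" using T(3)[OF A] unfolding t2[symmetric]
    by (rule power2_less_imp_less) (use d in simp)
  then show "a < 1" by (simp add: a_eq)
  show "\<alpha> * ((1 - a ^ 3 + b ^ 3) / 3) * (a\<^sup>2 + b\<^sup>2) =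
      3 * ((1 - a ^ 3 + b ^ 3) / 3)\<^sup>2 - \<alpha> * ((1 - a ^ 5 + b ^ 5) / 5)"
    using balance[of t] T(1)[OF A] unfolding a_eq b_eq t2 by simp
qed

section \<open>Central mass and its limit\<close>

text \<open>To first order the outer radicand is (1 - 5\<alpha>/3)/(1 - \<alpha>), about 1 -
  2\<alpha>/3. Half its root is about 1/2 - \<alpha>/6, and subtracting (1 - \<alpha>)/2 leaves
  \<alpha>/3.\<close>

lemma cut_b_limit: "((\<lambda>\<alpha>. cut_b \<alpha> / \<alpha>) \<longlongrightarrow> 1 / 3) (at_right 0)"
proof -
  \<comment> \<open>Normalised so that the radicands have limit \<open>1\<close>; \<open>real_asymp\<close> cannot see that \<open>sqrt 5 * sqrt 45 = 15\<close>.\<close>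
  have cut_b_eq: "cut_b \<alpha> = 1 / 2 * sqrt ((1 - \<alpha> / 3 + \<alpha>^2 / 3 - \<alpha>^3 + 4 / 9 * \<alpha>^4
      - 4 / 3 * \<alpha> * sqrt (1 - 2 * \<alpha> + 2 * \<alpha>^2 - 5 / 3 * \<alpha>^3 + 19 / 15 * \<alpha>^4 - 3 / 5 * \<alpha>^5 + \<alpha>^6 / 9))
      / (1 - \<alpha>)) - 1 / 2 * (1 - \<alpha>)" (is "_ = 1 / 2 * sqrt ((?N - 4 / 3 * \<alpha> * sqrt ?Q) / _) - _") for \<alpha>
  proof -
    have "sqrt 5 * sqrt (45 - 90 * \<alpha> + 90 * \<alpha>^2 - 75 * \<alpha>^3 + 57 * \<alpha>^4 - 27 * \<alpha>^5 + 5 * \<alpha>^6) =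
        sqrt (15\<^sup>2 * ?Q)"
      unfolding real_sqrt_mult[symmetric] by (simp add: algebra_simps)
    also have "\<dots> = 15 * sqrt ?Q"
      unfolding real_sqrt_mult by simp
    finally have Q: "4 * \<alpha> * sqrt 5 * sqrt (45 - 90 * \<alpha> + 90 * \<alpha>^2 - 75 * \<alpha>^3 + 57 * \<alpha>^4
        - 27 * \<alpha>^5 + 5 * \<alpha>^6) = 60 * \<alpha> * sqrt ?Q"
      by (simp add: mult.assoc)
    have N: "45 - 15 * \<alpha> + 15 * \<alpha>^2 - 45 * \<alpha>^3 + 20 * \<alpha>^4 = 45 * ?N"
      by (simp add: algebra_simps)
    \<comment> \<open>At \<alpha> = 1 both sides are 0 by the convention for division by zero, so
      the rewriting is valid for every \<alpha>.\<close>
    have "(45 * n - 60 * \<alpha> * q) / (180 * (1 - \<alpha>)) = (1 / 2)\<^sup>2 * ((n - 4 / 3 * \<alpha> * q) / (1 - \<alpha>))" for n q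
      by (cases "\<alpha> = 1") (simp_all add: field_simps power2_eq_square)
    then show ?thesis
      unfolding cut_b_def cut_a_def Q N by (simp only: real_sqrt_mult real_sqrt_abs) (simp add: field_simps)
  qed
  show ?thesis
    unfolding cut_b_eq by real_asymp
qed

text \<open>The density is 1/2 on an interval of length 2b.\<close>

lemma measure_cut_center:
  assumes "0 \<le> b" "b < a" "a \<le> 1"
  shows "measure (design_of (cut_density a b)) {-b..b} = b"
proof -
  have "emeasure (design_of (cut_density a b)) {-b..b} =
      (\<integral>\<^sup>+x. ennreal (cut_density a b x) * indicator {-b..b} x \<partial>lborel)"
    unfolding design_of_def cut_density_def by (rule emeasure_density) auto
  also have "\<dots> = (\<integral>\<^sup>+x. ennreal (1 / 2) * indicator {-b..b} x \<partial>lborel)"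
    by (intro nn_integral_cong) (auto simp: cut_density_def indicator_def)
  also have "\<dots> = ennreal b"
    using assms by (subst nn_integral_cmult_indicator) (simp_all add: ennreal_mult[symmetric] del: ennreal_half)
  finally show ?thesis using assms by (simp add: measure_def)
qed

text \<open>Unique existence belongs to the claim because \<open>D_optimal_design\<close> is a
  definite description and would otherwise say nothing about an optimal design.\<close>

theorem theorem5p4:
  shows "(\<forall>\<alpha>::real. 0 < \<alpha> \<and> \<alpha> < 1 \<longrightarrow>
            (\<exists>!\<xi>. is_D_optimal uniform_density \<alpha> \<xi>) \<and>
            D_optimal_design uniform_density \<alpha> =
              density lborel (\<lambda>x. ennreal (1 / 2 *
                indicator ({-1..- cut_a \<alpha>} \<union> {- cut_b \<alpha>..cut_b \<alpha>} \<union> {cut_a \<alpha>..1}) x))) \<and>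
         ((\<lambda>\<alpha>. measure (D_optimal_design uniform_density \<alpha>) {- cut_b \<alpha>..cut_b \<alpha>} / \<alpha>)
            \<longlongrightarrow> 1 / 3) (at_right 0)"
proof -
  define F where "F \<alpha> = cut_density (cut_a \<alpha>) (cut_b \<alpha>)" for \<alpha>
  have opt: "is_D_optimal uniform_density \<alpha> (design_of (F \<alpha>))"
    and uniq: "\<And>\<xi>. is_D_optimal uniform_density \<alpha> \<xi> \<Longrightarrow> \<xi> = design_of (F \<alpha>)"
    and center: "measure (design_of (F \<alpha>)) {- cut_b \<alpha>..cut_b \<alpha>} = cut_b \<alpha>"
    if \<alpha>: "0 < \<alpha>" "\<alpha> < 1" for \<alpha>
  proof -
    note props = cut_a_b_properties[OF \<alpha>]
    have ab: "0 \<le> cut_b \<alpha>" "cut_b \<alpha> < cut_a \<alpha>" "cut_a \<alpha> \<le> 1"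
      using props(1-3) by auto
    have mass: "1 - cut_a \<alpha> + cut_b \<alpha> = \<alpha>" by (simp add: cut_b_def)
    \<comment> \<open>With the mass and the moments written out, the balance assumption becomes
      exactly the identity in \<open>props(4)\<close>.\<close>
    note D_opt = cut_density_D_optimal[OF ab, unfolded mass moments_cut_density[OF ab],
        OF \<alpha>(1) props(4), folded F_def]
    show "is_D_optimal uniform_density \<alpha> (design_of (F \<alpha>))"
      by (rule D_opt(1))
    show "\<xi> = design_of (F \<alpha>)" if "is_D_optimal uniform_density \<alpha> \<xi>" for \<xi>
      using that by (rule D_opt(2))
    show "measure (design_of (F \<alpha>)) {- cut_b \<alpha>..cut_b \<alpha>} = cut_b \<alpha>"
      unfolding F_def by (rule measure_cut_center[OF ab])
  qed
  have the: "D_optimal_design uniform_density \<alpha> = design_of (F \<alpha>)" if "0 < \<alpha>" "\<alpha> < 1" for \<alpha>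
    unfolding D_optimal_design_def using opt[OF that] uniq[OF that] by (rule the_equality)
  \<comment> \<open>The limit only sees \<alpha> in (0,1), where the central mass is
    \<open>cut_b \<alpha>\<close>.\<close>
  have "\<forall>\<^sub>F \<alpha> in at_right 0. cut_b \<alpha> / \<alpha> =
      measure (D_optimal_design uniform_density \<alpha>) {- cut_b \<alpha>..cut_b \<alpha>} / \<alpha>"
    by (rule eventually_mono[OF eventually_at_right_real[OF zero_less_one]]) (auto simp: the center)
  then have "((\<lambda>\<alpha>. measure (D_optimal_design uniform_density \<alpha>) {- cut_b \<alpha>..cut_b \<alpha>} / \<alpha>)
      \<longlongrightarrow> 1 / 3) (at_right 0)"
    by (rule Lim_transform_eventually[OF cut_b_limit])
  moreover have "(\<exists>!\<xi>. is_D_optimal uniform_density \<alpha> \<xi>) \<and>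
      D_optimal_design uniform_density \<alpha> = density lborel (\<lambda>x. ennreal (1 / 2 *
        indicator ({-1..- cut_a \<alpha>} \<union> {- cut_b \<alpha>..cut_b \<alpha>} \<union> {cut_a \<alpha>..1}) x))"
    if "0 < \<alpha> \<and> \<alpha> < 1" for \<alpha>
  proof
    show "\<exists>!\<xi>. is_D_optimal uniform_density \<alpha> \<xi>"
      using that opt uniq by blast
    show "D_optimal_design uniform_density \<alpha> = density lborel (\<lambda>x. ennreal (1 / 2 *
        indicator ({-1..- cut_a \<alpha>} \<union> {- cut_b \<alpha>..cut_b \<alpha>} \<union> {cut_a \<alpha>..1}) x))"
      using the that by (simp add: F_def design_of_def cut_density_def)
  qed
  ultimately show ?thesis by blast
qed

end
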